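(* Let $K:\mathbb{R}^n\to\mathbb{R}$ be a measurable function with $K(z)\ge 0$, $K(-z)=K(z)$ and $\int_{\mathbb{R}^n}\min(1,|z|)K(z)\,dz<\infty$. Let $\Omega\subset\mathbb{R}^n$ be a bounded open set with $\mathcal{P}(\Omega)<\infty$, let $E\subset\mathbb{R}^n$ be measurable, and let $\phi_E:\mathbb{R}^n\to\mathbb{R}$ be a measurable function such that: (i) $E=\{x\in\mathbb{R}^n:\phi_E(x)>0\}$ up to a set of measure zero; (ii) the limit defining $H_K[\phi_E](x)$ exists for a.e. $x\in\Omega$, and the functions $x\mapsto \int_{\mathbb{R}^n\setminus B_\varepsilon(x)}\operatorname{sign}(\phi_E(x)-\phi_E(y))K(x-y)\,dy$ converge in $L^1(\Omega)$ to $H_K[\phi_E]$ as $\varepsilon\downarrow 0$. Then, for every measurable set $F\subset\mathbb{R}^n$ such that $F\setminus\Omega=E\setminus\Omega$ and $\mathcal{P}_\Omega(F)<\infty$, $$\mathcal{C}_\Omega(F)=2\int_{F\cap\Omega}H_K[\phi_E](x)\,dx+2\int_{E\setminus\Omega}dx\int_{\Omega}dy\;\operatorname{sign}(\phi_E(x)-\phi_E(y))\,K(x-y).$$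
   Context: Notation: $A^c=\mathbb{R}^n\setminus A$, and $\mathbf{1}_A$ is the characteristic function of $A$. For disjoint measurable sets $A,B$, $\mathcal{L}(A,B)=\int_A\int_B K(x-y)\,dy\,dx$. $\mathcal{P}(\Omega)=\mathcal{L}(\Omega,\Omega^c)$. The $K$-nonlocal perimeter of $F$ inside $\Omega$ is $\mathcal{P}_\Omega(F)=\mathcal{L}(F\cap\Omega,F^c\cap\Omega)+\mathcal{L}(F\cap\Omega,F^c\cap\Omega^c)+\mathcal{L}(F^c\cap\Omega,F\cap\Omega^c)$. $\operatorname{sign}(t)=-1,0,1$ for $t<0$, $t=0$, $t>0$ respectively. For a measurable $\phi_E:\mathbb{R}^n\to\mathbb{R}$, $$H_K[\phi_E](x)=\lim_{\varepsilon\downarrow0}\int_{\mathbb{R}^n\setminus B_\varepsilon(x)}\operatorname{sign}(\phi_E(x)-\phi_E(y))K(x-y)\,dy$$ whenever the limit exists. The calibration associated with $\phi_E$ is defined, for measurable $F$ with $F\setminus\Omega=E\setminus\Omega$ and $\mathcal{P}_\Omega(F)<\infty$, by $$\mathcal{C}_\Omega(F)=\int_{(\mathbb{R}^n\times\mathbb{R}^n)\setminus(\Omega^c\times\Omega^c)}\operatorname{sign}(\phi_E(x)-\phi_E(y))\,(\mathbf{1}_F(x)-\mathbf{1}_F(y))\,K(x-y)\,dx\,dy.$$ *)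

theory Defs
  imports "HOL-Analysis.Analysis"
begin

text \<open>
  Throughout, measurability and integration refer to Lebesgue measure (the completion of the
  Borel one).  The kernel is nonnegative, so interactions are extended nonnegative integrals, with
  finiteness expressed by \<open>< \<infinity>\<close>.
\<close>

definition interaction :: "(real ^ 'n \<Rightarrow> real) \<Rightarrow> (real ^ 'n) set \<Rightarrow> (real ^ 'n) set \<Rightarrow> ennreal" where
  "interaction K A B =
     (\<integral>\<^sup>+ x \<in> A. (\<integral>\<^sup>+ y \<in> B. ennreal (K (x - y)) \<partial>lebesgue) \<partial>lebesgue)"

definition nonlocal_perimeter :: "(real ^ 'n \<Rightarrow> real) \<Rightarrow> (real ^ 'n) set \<Rightarrow> ennreal" where
  "nonlocal_perimeter K \<Omega> = interaction K \<Omega> (- \<Omega>)"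

definition nonlocal_perimeter_in ::
    "(real ^ 'n \<Rightarrow> real) \<Rightarrow> (real ^ 'n) set \<Rightarrow> (real ^ 'n) set \<Rightarrow> ennreal" where
  "nonlocal_perimeter_in K \<Omega> F =
     interaction K (F \<inter> \<Omega>) (- F \<inter> \<Omega>)
     + interaction K (F \<inter> \<Omega>) (- F \<inter> - \<Omega>)
     + interaction K (- F \<inter> \<Omega>) (F \<inter> - \<Omega>)"

definition truncated_curvature ::
    "(real ^ 'n \<Rightarrow> real) \<Rightarrow> (real ^ 'n \<Rightarrow> real) \<Rightarrow> real \<Rightarrow> real ^ 'n \<Rightarrow> real" where
  "truncated_curvature K \<phi> \<epsilon> x =
     (LINT y:- ball x \<epsilon>|lebesgue. sgn (\<phi> x - \<phi> y) * K (x - y))"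

definition curvature_exists :: "(real ^ 'n \<Rightarrow> real) \<Rightarrow> (real ^ 'n \<Rightarrow> real) \<Rightarrow> real ^ 'n \<Rightarrow> bool" where
  "curvature_exists K \<phi> x \<longleftrightarrow>
     (\<exists>l. ((\<lambda>\<epsilon>. truncated_curvature K \<phi> \<epsilon> x) \<longlongrightarrow> l) (at_right 0))"

text \<open>The value is meaningful only at points where \<open>curvature_exists\<close> holds.\<close>

definition nonlocal_curvature :: "(real ^ 'n \<Rightarrow> real) \<Rightarrow> (real ^ 'n \<Rightarrow> real) \<Rightarrow> real ^ 'n \<Rightarrow> real" where
  "nonlocal_curvature K \<phi> x = Lim (at_right 0) (\<lambda>\<epsilon>. truncated_curvature K \<phi> \<epsilon> x)"

definition tendsto_L1_on ::
    "(real ^ 'n) set \<Rightarrow> ('i \<Rightarrow> real ^ 'n \<Rightarrow> real) \<Rightarrow> (real ^ 'n \<Rightarrow> real) \<Rightarrow> 'i filter \<Rightarrow> bool" where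
  "tendsto_L1_on \<Omega> f g \<F> \<longleftrightarrow>
     (\<forall>\<^sub>F i in \<F>. set_integrable lebesgue \<Omega> (f i)) \<and>
     set_integrable lebesgue \<Omega> g \<and>
     ((\<lambda>i. LINT x:\<Omega>|lebesgue. \<bar>f i x - g x\<bar>) \<longlongrightarrow> 0) \<F>"

text \<open>
  The integral is taken with respect to Lebesgue measure on \<open>\<real>\<^sup>n \<times> \<real>\<^sup>n\<close> (again the complete one,
  not the product of the two completed factors).  It is only considered for measurable \<open>F\<close>
  agreeing with \<open>E\<close> outside \<open>\<Omega>\<close> and of finite perimeter inside \<open>\<Omega>\<close>; finiteness of the perimeter
  makes the integrand absolutely integrable, so the convention that the integral of a
  non-integrable function is 0 plays no role.
\<close>

definition calibration ::
    "(real ^ 'n \<Rightarrow> real) \<Rightarrow> (real ^ 'n \<Rightarrow> real) \<Rightarrow> (real ^ 'n) set \<Rightarrow> (real ^ 'n) set \<Rightarrow> real" where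
  "calibration K \<phi> \<Omega> F =
     (LINT p:UNIV - (- \<Omega>) \<times> (- \<Omega>)|lebesgue.
        sgn (\<phi> (fst p) - \<phi> (snd p))
        * (indicator F (fst p) - indicator F (snd p)) * K (fst p - snd p))"

end

theory Submission
  imports Defs
begin

text \<open>
  Write \<open>a (x, y) = sgn (\<phi> x - \<phi> y) * K (x - y)\<close> and let \<open>D\<close> be the complement of
  \<open>(- \<Omega>) \<times> (- \<Omega>)\<close>.  Since \<open>K\<close> is even, \<open>a\<close> is antisymmetric, while \<open>D\<close> is symmetric.
  Removing the strip \<open>dist x y < \<epsilon>\<close> around the diagonal makes \<open>a\<close> absolutely integrable
  on \<open>D\<close>: the set \<open>\<Omega>\<close> has finite measure and \<open>K\<close> is integrable away from the origin.
  For the truncated kernel the two terms of \<open>1_F(x) - 1_F(y)\<close> may therefore be separated and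
  contribute equally, so that the calibration is twice the integral of \<open>a (x, y)\<close> over the pairs of
  \<open>D\<close> with \<open>x \<in> F\<close>.  Splitting according to whether \<open>x\<close> lies in \<open>\<Omega>\<close> and applying Fubini
  gives the claimed identity for the truncated kernel
  (lemma \<open>integral_antisymmetric_kernel\<close>).

  Let \<open>\<epsilon>\<close> tend to 0.  The calibration converges by dominated convergence because \<open>F\<close> has finite
  perimeter in \<open>\<Omega>\<close>, which makes \<open>\<bar>1_F(x) - 1_F(y)\<bar> * K (x - y)\<close> integrable on \<open>D\<close>
  (lemma \<open>integrable_jump_kernel\<close>); the integral over \<open>(F - \<Omega>) \<times> \<Omega>\<close> converges by
  dominated convergence because \<open>\<Omega>\<close> has finite perimeter; the integral over \<open>F \<inter> \<Omega>\<close> converges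
  because the truncated curvatures converge in \<open>L\<^sup>1\<close>.  This is lemma \<open>calibration_identity_limit\<close>.

  All of this takes place on the product of two Borel-Lebesgue measures.  The hypotheses only give
  Lebesgue measurability, so \<open>K\<close>, \<open>\<phi>\<close> and \<open>F\<close> are first replaced by Borel representatives.
  This changes none of the integrals: the preimage of a null set under either projection, or under
  \<open>(x, y) \<mapsto> x - y\<close>, is a null set.
\<close>

section \<open>Null sets in the product and Borel representatives\<close>

lemma lborel_distr_reflect:
  fixes x :: "'a::euclidean_space"
  shows "distr lborel borel (\<lambda>y. x - y) = lborel"
  by (subst lborel_affine[of "-1" x]) (auto simp: density_1)

lemma AE_lborel_reflect:
  fixes x :: "'a::euclidean_space"
  assumes "AE z in lborel. P z"
  shows "AE y in lborel. P (x - y)"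
proof -
  from assms have "AE z in distr lborel borel (\<lambda>y. x - y). P z"
    unfolding lborel_distr_reflect .
  then show ?thesis
    by (intro AE_distrD[of "\<lambda>y. x - y" lborel borel P]) simp_all
qed

text \<open>
  The assumption on \<open>g\<close> says that almost every slice \<open>g (x, _)\<close> pulls null sets back to null sets.
  The predicate \<open>P\<close> need not be measurable.
\<close>
lemma AE_lborel_pair_compose:
  fixes g :: "'a::euclidean_space \<times> 'b::euclidean_space \<Rightarrow> 'c::euclidean_space"
  assumes [measurable]: "g \<in> borel_measurable (lborel \<Otimes>\<^sub>M lborel)"
    and P: "AE z in lborel. P z"
    and g: "\<And>Q. AE z in lborel. Q z \<Longrightarrow> AE x in lborel. AE y in lborel. Q (g (x, y))"
  shows "AE p in lborel \<Otimes>\<^sub>M lborel. P (g p)"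
proof -
  obtain N where N: "N \<in> null_sets lborel" "{z. \<not> P z} \<subseteq> N"
    using P unfolding eventually_ae_filter by auto
  have [measurable]: "N \<in> sets borel" using N by auto
  have "AE p in lborel \<Otimes>\<^sub>M lborel. g p \<notin> N"
  proof (rule lborel_pair.AE_pair_measure)
    show "AE x in lborel. AE y in lborel. g (x, y) \<notin> N"
      using AE_not_in[OF N(1)] by (rule g)
  qed measurable
  then show ?thesis
    by eventually_elim (use N(2) in auto)
qed

lemma AE_lborel_fst: "AE z in lborel. P z \<Longrightarrow> AE p in lborel \<Otimes>\<^sub>M lborel. P (fst p)"
  by (rule AE_lborel_pair_compose) auto

lemma AE_lborel_snd: "AE z in lborel. P z \<Longrightarrow> AE p in lborel \<Otimes>\<^sub>M lborel. P (snd p)"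
  by (rule AE_lborel_pair_compose) auto

lemma AE_lborel_diff:
  assumes "AE z in lborel. P (z :: 'a::euclidean_space)"
  shows "AE p in lborel \<Otimes>\<^sub>M lborel. P (fst p - snd p)"
proof (rule AE_lborel_pair_compose[OF _ assms])
  fix Q :: "'a \<Rightarrow> bool"
  assume "AE z in lborel. Q z"
  then show "AE x in lborel. AE y in lborel. Q (fst (x, y) - snd (x, y))"
    by (simp add: AE_lborel_reflect)
qed simp

text \<open>Measurability of \<open>f\<close> is not assumed: it follows since Lebesgue measure is complete.\<close>
lemma integral_lebesgue_eq_lborel:
  fixes f g :: "'a::euclidean_space \<Rightarrow> real"
  assumes g: "g \<in> borel_measurable borel" and ae: "AE x in lborel. f x = g x"
  shows "integral\<^sup>L lebesgue f = integral\<^sup>L lborel g"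
proof -
  have g': "g \<in> borel_measurable lebesgue"
    using g by (intro measurable_completion) simp
  have ae': "AE x in lebesgue. f x = g x" "AE x in lebesgue. g x = f x"
    using AE_completion[OF ae] by (auto elim: eventually_mono)
  have "f \<in> borel_measurable lebesgue"
    by (rule borel_measurable_AE[OF g' ae'(2)])
  then have "integral\<^sup>L lebesgue f = integral\<^sup>L lebesgue g"
    using g' ae'(1) by (rule integral_cong_AE)
  also have "\<dots> = integral\<^sup>L lborel g"
    using g by (intro integral_completion) simp
  finally show ?thesis .
qed

text \<open>
  A Borel function that agrees with \<open>K\<close> almost everywhere need be neither even nor nonnegative;
  symmetrizing it and taking the positive part restores both properties at every point.
\<close>
lemma even_borel_representative:
  fixes K :: "'a::euclidean_space \<Rightarrow> real"
  assumes K: "K \<in> borel_measurable lebesgue" and nonneg: "\<And>z. 0 \<le> K z" and even: "\<And>z. K (- z) = K z"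
  obtains k where "k \<in> borel_measurable borel" "\<And>z. 0 \<le> k z" "\<And>z. k (- z) = k z"
    "AE z in lborel. K z = k z"
proof -
  obtain K0 where [measurable]: "K0 \<in> borel_measurable borel" and K0: "AE z in lborel. K z = K0 z"
    using completion_ex_borel_measurable_real[OF K] by auto
  define k where "k z = max 0 ((K0 z + K0 (- z)) / 2)" for z
  show ?thesis
  proof (rule that[of k])
    show "k \<in> borel_measurable borel"
      unfolding k_def by measurable
    have "AE z in lborel. K (- z) = K0 (- z)"
      using AE_lborel_reflect[OF K0, of 0] by simp
    with K0 show "AE z in lborel. K z = k z"
    proof eventually_elim
      case (elim z)
      then show ?case using nonneg[of z] even[of z] by (simp add: k_def)
    qed
  qed (simp_all add: k_def add.commute)
qed

section \<open>Integrating an antisymmetric kernel against a jump\<close>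

lemma integral_antisymmetric_kernel:
  fixes a :: "'a::euclidean_space \<times> 'a \<Rightarrow> real"
  assumes [measurable]: "\<Omega> \<in> sets borel" "F \<in> sets borel"
    and anti: "\<And>x y. a (y, x) = - a (x, y)"
    and int: "integrable (lborel \<Otimes>\<^sub>M lborel) (\<lambda>p. indicator (\<Omega> \<times> UNIV) p * a p)"
    and a[measurable]: "a \<in> borel_measurable (lborel \<Otimes>\<^sub>M lborel)"
  shows "(\<integral>p. indicator (UNIV - (- \<Omega>) \<times> (- \<Omega>)) p
              * (indicator F (fst p) - indicator F (snd p)) * a p \<partial>(lborel \<Otimes>\<^sub>M lborel)) =
    2 * (\<integral>x. indicator (F \<inter> \<Omega>) x * (\<integral>y. a (x, y) \<partial>lborel) \<partial>lborel)
    + 2 * (\<integral>p. indicator (F - \<Omega>) (fst p) * indicator \<Omega> (snd p) * a p \<partial>(lborel \<Otimes>\<^sub>M lborel))"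
proof -
  let ?M = "lborel \<Otimes>\<^sub>M lborel :: ('a \<times> 'a) measure"
  define f where "f p = indicator (F \<inter> \<Omega>) (fst p) * a p" for p
  define g where "g p = indicator (F - \<Omega>) (fst p) * indicator \<Omega> (snd p) * a p" for p
  have int': "integrable ?M (\<lambda>p. indicator \<Omega> (snd p) * a p)"
  proof -
    have "integrable ?M (\<lambda>p. - (case p of (x, y) \<Rightarrow> indicator (\<Omega> \<times> UNIV) (y, x) * a (y, x)))"
      by (intro Bochner_Integration.integrable_minus lborel_pair.integrable_product_swap int)
    also have "(\<lambda>p. - (case p of (x, y) \<Rightarrow> indicator (\<Omega> \<times> UNIV) (y, x) * a (y, x)))
        = (\<lambda>p. indicator \<Omega> (snd p) * a p)"
    proof
      fix p :: "'a \<times> 'a"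
      obtain x y where p: "p = (x, y)" by (cases p)
      show "- (case p of (x, y) \<Rightarrow> indicator (\<Omega> \<times> UNIV) (y, x) * a (y, x)) = indicator \<Omega> (snd p) * a p"
        unfolding p using anti[of x y] by (auto simp: indicator_def)
    qed
    finally show ?thesis .
  qed
  have f: "integrable ?M f"
    unfolding f_def by (rule Bochner_Integration.integrable_bound[OF int]) (auto simp: indicator_def)
  have g: "integrable ?M g"
    unfolding g_def by (rule Bochner_Integration.integrable_bound[OF int']) (auto simp: indicator_def)
  have fg: "integrable ?M (\<lambda>p. f p + g p)"
    using f g by simp
  \<comment> \<open>By antisymmetry, the term with \<open>indicator F (snd p)\<close> is the mirror image of the other one.\<close>
  have "(\<integral>p. indicator (UNIV - (- \<Omega>) \<times> (- \<Omega>)) p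
              * (indicator F (fst p) - indicator F (snd p)) * a p \<partial>?M)
      = (\<integral>p. (f p + g p) + (case p of (x, y) \<Rightarrow> f (y, x) + g (y, x)) \<partial>?M)"
  proof (rule Bochner_Integration.integral_cong[OF refl])
    fix p :: "'a \<times> 'a"
    obtain x y where p: "p = (x, y)" by (cases p)
    show "indicator (UNIV - (- \<Omega>) \<times> (- \<Omega>)) p
              * (indicator F (fst p) - indicator F (snd p)) * a p
        = (f p + g p) + (case p of (x, y) \<Rightarrow> f (y, x) + g (y, x))"
      unfolding p f_def g_def using anti[of x y] by (auto simp: indicator_def)
  qed
  also have "\<dots> = 2 * (\<integral>p. f p + g p \<partial>?M)"
    using lborel_pair.integrable_product_swap[OF fg] fg
      lborel_pair.integral_product_swap[OF borel_measurable_integrable[OF fg]]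
    by (subst Bochner_Integration.integral_add) auto
  also have "(\<integral>p. f p + g p \<partial>?M) = integral\<^sup>L ?M f + integral\<^sup>L ?M g"
    using f g by simp
  also have "integral\<^sup>L ?M f = (\<integral>x. \<integral>y. f (x, y) \<partial>lborel \<partial>lborel)"
    by (rule lborel_pair.integral_fst'[OF f, symmetric])
  also have "\<dots> = (\<integral>x. indicator (F \<inter> \<Omega>) x * (\<integral>y. a (x, y) \<partial>lborel) \<partial>lborel)"
    unfolding f_def by simp
  finally show ?thesis
    unfolding g_def by (simp only: distrib_left)
qed

text \<open>
  The sets \<open>T n\<close> are symmetric truncations, exhausting the region where \<open>a\<close> does not vanish.  The
  kernel \<open>a\<close> itself need not be integrable on \<open>\<Omega> \<times> UNIV\<close>, so the contribution of \<open>F \<inter> \<Omega>\<close> is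
  given only as a limit \<open>L\<close> of truncated integrals.
\<close>
lemma calibration_identity_limit:
  fixes a :: "'a::euclidean_space \<times> 'a \<Rightarrow> real" and T :: "nat \<Rightarrow> ('a \<times> 'a) set"
  assumes [measurable]: "\<Omega> \<in> sets borel" "F \<in> sets borel" "\<And>n. T n \<in> sets (lborel \<Otimes>\<^sub>M lborel)"
    and a[measurable]: "a \<in> borel_measurable (lborel \<Otimes>\<^sub>M lborel)"
    and anti: "\<And>x y. a (y, x) = - a (x, y)"
    and T_sym: "\<And>n x y. (y, x) \<in> T n \<longleftrightarrow> (x, y) \<in> T n"
    and T_exhausts: "\<And>p. a p \<noteq> 0 \<Longrightarrow> \<forall>\<^sub>F n in sequentially. p \<in> T n"
    and int_T: "\<And>n. integrable (lborel \<Otimes>\<^sub>M lborel)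
                 (\<lambda>p. indicator (\<Omega> \<times> UNIV) p * (indicator (T n) p * a p))"
    and int_jump: "integrable (lborel \<Otimes>\<^sub>M lborel)
                 (\<lambda>p. indicator (UNIV - (- \<Omega>) \<times> (- \<Omega>)) p
                    * (indicator F (fst p) - indicator F (snd p)) * a p)"
    and int_cross: "integrable (lborel \<Otimes>\<^sub>M lborel) (\<lambda>p. indicator ((- \<Omega>) \<times> \<Omega>) p * a p)"
    and lim: "(\<lambda>n. \<integral>x. indicator (F \<inter> \<Omega>) x * (\<integral>y. indicator (T n) (x, y) * a (x, y) \<partial>lborel) \<partial>lborel)
                 \<longlonglongrightarrow> L"
  shows "(\<integral>p. indicator (UNIV - (- \<Omega>) \<times> (- \<Omega>)) p
              * (indicator F (fst p) - indicator F (snd p)) * a p \<partial>(lborel \<Otimes>\<^sub>M lborel)) =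
    2 * L + 2 * (\<integral>x. indicator (F - \<Omega>) x * (\<integral>y. indicator \<Omega> y * a (x, y) \<partial>lborel) \<partial>lborel)"
proof -
  let ?M = "lborel \<Otimes>\<^sub>M lborel :: ('a \<times> 'a) measure"
  let ?J = "\<lambda>p. indicator (UNIV - (- \<Omega>) \<times> (- \<Omega>)) p
              * (indicator F (fst p) - indicator F (snd p)) :: real"
  let ?C = "\<lambda>p. indicator (F - \<Omega>) (fst p) * indicator \<Omega> (snd p) :: real"
  have ptw: "(\<lambda>n. c * (indicator (T n) p * a p)) \<longlonglongrightarrow> c * a p" for c p
  proof (cases "a p = 0")
    case False
    from T_exhausts[OF this] have "\<forall>\<^sub>F n in sequentially. c * (indicator (T n) p * a p) = c * a p"
      by eventually_elim simp
    then show ?thesis by (rule tendsto_eventually)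
  qed simp
  have int_C: "integrable ?M (\<lambda>p. ?C p * a p)"
    by (rule Bochner_Integration.integrable_bound[OF int_cross]) (auto simp: indicator_def)
  have trunc: "(\<lambda>n. \<integral>p. c p * (indicator (T n) p * a p) \<partial>?M) \<longlonglongrightarrow> (\<integral>p. c p * a p \<partial>?M)"
    if [measurable]: "c \<in> borel_measurable ?M" and c: "integrable ?M (\<lambda>p. c p * a p)"
    for c :: "'a \<times> 'a \<Rightarrow> real"
  proof (rule integral_dominated_convergence)
    show "integrable ?M (\<lambda>p. norm (c p * a p))"
      using c by (rule integrable_norm)
    show "AE p in ?M. (\<lambda>n. c p * (indicator (T n) p * a p)) \<longlonglongrightarrow> c p * a p"
      by (rule AE_I2) (rule ptw)
    show "AE p in ?M. norm (c p * (indicator (T n) p * a p)) \<le> norm (c p * a p)" for n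
      by (rule AE_I2) (simp add: indicator_def)
  qed measurable
  have J: "(\<lambda>n. \<integral>p. ?J p * (indicator (T n) p * a p) \<partial>?M) \<longlonglongrightarrow> (\<integral>p. ?J p * a p \<partial>?M)"
    by (rule trunc[OF _ int_jump]) measurable
  have C: "(\<lambda>n. \<integral>p. ?C p * (indicator (T n) p * a p) \<partial>?M) \<longlonglongrightarrow> (\<integral>p. ?C p * a p \<partial>?M)"
    by (rule trunc[OF _ int_C]) measurable
  have id: "(\<integral>p. ?J p * (indicator (T n) p * a p) \<partial>?M) =
      2 * (\<integral>x. indicator (F \<inter> \<Omega>) x * (\<integral>y. indicator (T n) (x, y) * a (x, y) \<partial>lborel) \<partial>lborel)
      + 2 * (\<integral>p. ?C p * (indicator (T n) p * a p) \<partial>?M)" for n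
  proof (rule integral_antisymmetric_kernel)
    show "indicator (T n) (y, x) * a (y, x) = - (indicator (T n) (x, y) * a (x, y))" for x y
      using anti[of y x] T_sym[of y x n] by (simp add: indicator_def)
    show "integrable ?M (\<lambda>p. indicator (\<Omega> \<times> UNIV) p * (indicator (T n) p * a p))"
      by (rule int_T)
    show "(\<lambda>p. indicator (T n) p * a p) \<in> borel_measurable ?M"
      by measurable
  qed fact+
  have "(\<lambda>n. \<integral>p. ?J p * (indicator (T n) p * a p) \<partial>?M)
      \<longlonglongrightarrow> 2 * L + 2 * (\<integral>p. ?C p * a p \<partial>?M)"
    unfolding id by (intro tendsto_add tendsto_mult_left lim C)
  with J have "(\<integral>p. ?J p * a p \<partial>?M) = 2 * L + 2 * (\<integral>p. ?C p * a p \<partial>?M)"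
    by (rule LIMSEQ_unique)
  also have "(\<integral>p. ?C p * a p \<partial>?M)
      = (\<integral>x. \<integral>y. ?C (x, y) * a (x, y) \<partial>lborel \<partial>lborel)"
    by (rule lborel_pair.integral_fst'[OF int_C, symmetric])
  also have "\<dots> = (\<integral>x. indicator (F - \<Omega>) x * (\<integral>y. indicator \<Omega> y * a (x, y) \<partial>lborel) \<partial>lborel)"
    by (simp only: fst_conv snd_conv mult.assoc integral_mult_right_zero)
  finally show ?thesis .
qed


section \<open>Integrability of the kernel\<close>

lemma interaction_eq_product_integral:
  fixes K k :: "real ^ 'n \<Rightarrow> real"
  assumes [measurable]: "k \<in> borel_measurable borel" "A' \<in> sets borel" "B' \<in> sets borel"
    and K: "AE z in lborel. K z = k z"
    and A: "AE x in lborel. x \<in> A \<longleftrightarrow> x \<in> A'" and B: "AE x in lborel. x \<in> B \<longleftrightarrow> x \<in> B'"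
  shows "interaction K A B
    = (\<integral>\<^sup>+p. ennreal (indicator A' (fst p) * indicator B' (snd p) * k (fst p - snd p)) \<partial>(lborel \<Otimes>\<^sub>M lborel))"
proof -
  have inner: "(\<integral>\<^sup>+y. ennreal (K (x - y)) * indicator B y \<partial>lborel)
      = (\<integral>\<^sup>+y. ennreal (k (x - y)) * indicator B' y \<partial>lborel)" for x
    by (rule nn_integral_cong_AE)
       (use AE_lborel_reflect[OF K, of x] B in eventually_elim, simp add: indicator_def)
  have "interaction K A B
      = (\<integral>\<^sup>+x. (\<integral>\<^sup>+y. ennreal (k (x - y)) * indicator B' y \<partial>lborel) * indicator A x \<partial>lborel)"
    unfolding interaction_def by (simp add: nn_integral_completion inner)
  also have "\<dots> = (\<integral>\<^sup>+x. (\<integral>\<^sup>+y. ennreal (k (x - y)) * indicator B' y \<partial>lborel) * indicator A' x \<partial>lborel)"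
    by (rule nn_integral_cong_AE) (use A in eventually_elim, simp add: indicator_def)
  also have "\<dots> = (\<integral>\<^sup>+x. (\<integral>\<^sup>+y. ennreal (indicator A' x * indicator B' y * k (x - y)) \<partial>lborel) \<partial>lborel)"
    by (rule nn_integral_cong) (auto simp: indicator_def intro!: nn_integral_cong)
  also have "\<dots> = (\<integral>\<^sup>+p. ennreal (indicator A' (fst p) * indicator B' (snd p) * k (fst p - snd p))
      \<partial>(lborel \<Otimes>\<^sub>M lborel))"
    by (subst lborel.nn_integral_fst[symmetric]) simp_all
  finally show ?thesis .
qed

lemma integrable_of_interaction_finite:
  fixes K k :: "real ^ 'n \<Rightarrow> real"
  assumes [measurable]: "k \<in> borel_measurable borel" "A' \<in> sets borel" "B' \<in> sets borel"
    and K: "AE z in lborel. K z = k z" and k: "\<And>z. 0 \<le> k z"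
    and AB: "AE x in lborel. x \<in> A \<longleftrightarrow> x \<in> A'" "AE x in lborel. x \<in> B \<longleftrightarrow> x \<in> B'"
    and fin: "interaction K A B < \<infinity>"
  shows "integrable (lborel \<Otimes>\<^sub>M lborel)
    (\<lambda>p. indicator A' (fst p) * indicator B' (snd p) * k (fst p - snd p))"
proof (rule integrableI_nonneg)
  show "(\<integral>\<^sup>+p. ennreal (indicator A' (fst p) * indicator B' (snd p) * k (fst p - snd p))
      \<partial>(lborel \<Otimes>\<^sub>M lborel)) < \<infinity>"
    using fin by (simp only: interaction_eq_product_integral[OF assms(1-4) AB])
qed (auto simp: k)

lemma integrable_swap:
  fixes f :: "'a::euclidean_space \<times> 'a \<Rightarrow> real"
  assumes "integrable (lborel \<Otimes>\<^sub>M lborel) f"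
  shows "integrable (lborel \<Otimes>\<^sub>M lborel) (\<lambda>p. f (snd p, fst p))"
  using lborel_pair.integrable_product_swap[OF assms] by (simp add: split_beta')

text \<open>
  The substitution \<open>z = x - y\<close> turns the inner integral into that of \<open>k\<close> over
  \<open>\<epsilon> \<le> norm z\<close>, and there \<open>k z \<le> min 1 (norm z) * k z / min 1 \<epsilon>\<close>.
\<close>
lemma integrable_kernel_off_diagonal:
  fixes k :: "'a::euclidean_space \<Rightarrow> real"
  assumes [measurable]: "k \<in> borel_measurable borel" "\<Omega> \<in> sets borel"
    and k: "\<And>z. 0 \<le> k z"
    and fin: "(\<integral>\<^sup>+ z. ennreal (min 1 (norm z) * k z) \<partial>lborel) < \<infinity>"
    and \<Omega>: "emeasure lborel \<Omega> < \<infinity>" and \<epsilon>: "0 < \<epsilon>"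
  shows "integrable (lborel \<Otimes>\<^sub>M lborel)
    (\<lambda>p. indicator \<Omega> (fst p) * (if \<epsilon> \<le> dist (fst p) (snd p) then k (fst p - snd p) else 0))"
proof (rule integrableI_nonneg)
  define h where "h z = (if \<epsilon> \<le> norm z then k z else 0)" for z
  have [measurable]: "h \<in> borel_measurable borel"
    unfolding h_def by measurable
  have h_le: "h z \<le> inverse (min 1 \<epsilon>) * (min 1 (norm z) * k z)" for z
  proof (cases "\<epsilon> \<le> norm z")
    case True
    then have "1 \<le> inverse (min 1 \<epsilon>) * min 1 (norm z)"
      using \<epsilon> by (auto simp: field_simps min_def)
    from mult_right_mono[OF this k[of z]] show ?thesis
      using True by (simp add: h_def mult.assoc)
  qed (use \<epsilon> k in \<open>simp add: h_def\<close>)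
  have "(\<integral>\<^sup>+z. ennreal (h z) \<partial>lborel)
      \<le> (\<integral>\<^sup>+z. ennreal (inverse (min 1 \<epsilon>)) * ennreal (min 1 (norm z) * k z) \<partial>lborel)"
    using h_le \<epsilon> k by (intro nn_integral_mono) (simp add: ennreal_mult[symmetric])
  also have "\<dots> = ennreal (inverse (min 1 \<epsilon>)) * (\<integral>\<^sup>+z. ennreal (min 1 (norm z) * k z) \<partial>lborel)"
    by (rule nn_integral_cmult) measurable
  also have "\<dots> < \<infinity>"
    using fin by (simp add: ennreal_mult_less_top)
  finally have h_fin: "(\<integral>\<^sup>+z. ennreal (h z) \<partial>lborel) < \<infinity>" .
  have shift: "(\<integral>\<^sup>+y. ennreal (h (x - y)) \<partial>lborel) = (\<integral>\<^sup>+z. ennreal (h z) \<partial>lborel)" for x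
  proof -
    have "(\<integral>\<^sup>+z. ennreal (h z) \<partial>lborel) = (\<integral>\<^sup>+z. ennreal (h z) \<partial>distr lborel borel (\<lambda>y. x - y))"
      by (simp only: lborel_distr_reflect)
    also have "\<dots> = (\<integral>\<^sup>+y. ennreal (h (x - y)) \<partial>lborel)"
      by (rule nn_integral_distr) measurable
    finally show ?thesis by simp
  qed
  have "(\<integral>\<^sup>+p. ennreal (indicator \<Omega> (fst p) * (if \<epsilon> \<le> dist (fst p) (snd p) then k (fst p - snd p) else 0))
        \<partial>(lborel \<Otimes>\<^sub>M lborel))
      = (\<integral>\<^sup>+p. indicator \<Omega> (fst p) * ennreal (h (fst p - snd p)) \<partial>(lborel \<Otimes>\<^sub>M lborel))"
    by (rule nn_integral_cong) (simp add: h_def dist_norm indicator_def)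
  also have "\<dots> = (\<integral>\<^sup>+x. \<integral>\<^sup>+y. indicator \<Omega> x * ennreal (h (x - y)) \<partial>lborel \<partial>lborel)"
    by (subst lborel.nn_integral_fst[symmetric]) simp_all
  also have "\<dots> = (\<integral>\<^sup>+x. (\<integral>\<^sup>+z. ennreal (h z) \<partial>lborel) * indicator \<Omega> x \<partial>lborel)"
    by (simp add: nn_integral_cmult shift mult.commute)
  also have "\<dots> = (\<integral>\<^sup>+z. ennreal (h z) \<partial>lborel) * emeasure lborel \<Omega>"
    by (rule nn_integral_cmult_indicator) simp
  also have "\<dots> < \<infinity>"
    using h_fin \<Omega> by (simp add: ennreal_mult_less_top)
  finally show "(\<integral>\<^sup>+p. ennreal (indicator \<Omega> (fst p)
      * (if \<epsilon> \<le> dist (fst p) (snd p) then k (fst p - snd p) else 0)) \<partial>(lborel \<Otimes>\<^sub>M lborel)) < \<infinity>" .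
qed (auto simp: k)

text \<open>
  A pair outside \<open>(- \<Omega>) \<times> (- \<Omega>)\<close> that is separated by \<open>F'\<close> belongs, up to swapping its
  entries, to one of the three products of sets whose interactions make up the perimeter in \<open>\<Omega>\<close>.
\<close>
lemma integrable_jump_kernel:
  fixes K k :: "real ^ 'n \<Rightarrow> real"
  assumes [measurable]: "k \<in> borel_measurable borel" "\<Omega> \<in> sets borel" "F' \<in> sets borel"
    and K: "AE z in lborel. K z = k z" and k: "\<And>z. 0 \<le> k z" and k_even: "\<And>z. k (- z) = k z"
    and F: "AE x in lborel. x \<in> F \<longleftrightarrow> x \<in> F'"
    and fin: "nonlocal_perimeter_in K \<Omega> F < \<infinity>"
  shows "integrable (lborel \<Otimes>\<^sub>M lborel)
    (\<lambda>p. indicator (UNIV - (- \<Omega>) \<times> (- \<Omega>)) p * (indicator F' (fst p) - indicator F' (snd p))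
       * k (fst p - snd p))"
proof -
  have fin1: "interaction K (F \<inter> \<Omega>) (- F \<inter> \<Omega>) < \<infinity>"
    and fin2: "interaction K (F \<inter> \<Omega>) (- F \<inter> - \<Omega>) < \<infinity>"
    and fin3: "interaction K (- F \<inter> \<Omega>) (F \<inter> - \<Omega>) < \<infinity>"
    using fin by (auto simp: nonlocal_perimeter_in_def)
  define h where "h p = indicator (F' \<inter> \<Omega>) (fst p) * indicator (- F' \<inter> \<Omega>) (snd p) * k (fst p - snd p)
      + indicator (F' \<inter> \<Omega>) (fst p) * indicator (- F' \<inter> - \<Omega>) (snd p) * k (fst p - snd p)
      + indicator (- F' \<inter> \<Omega>) (fst p) * indicator (F' \<inter> - \<Omega>) (snd p) * k (fst p - snd p)" for p
  have ae: "AE x in lborel. x \<in> F \<inter> \<Omega> \<longleftrightarrow> x \<in> F' \<inter> \<Omega>"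
      "AE x in lborel. x \<in> - F \<inter> \<Omega> \<longleftrightarrow> x \<in> - F' \<inter> \<Omega>"
      "AE x in lborel. x \<in> F \<inter> - \<Omega> \<longleftrightarrow> x \<in> F' \<inter> - \<Omega>"
      "AE x in lborel. x \<in> - F \<inter> - \<Omega> \<longleftrightarrow> x \<in> - F' \<inter> - \<Omega>"
    using F by (auto elim: eventually_mono)
  have h: "integrable (lborel \<Otimes>\<^sub>M lborel) h"
    unfolding h_def
  proof (intro Bochner_Integration.integrable_add)
    show "integrable (lborel \<Otimes>\<^sub>M lborel) (\<lambda>p. indicator (F' \<inter> \<Omega>) (fst p)
        * indicator (- F' \<inter> \<Omega>) (snd p) * k (fst p - snd p))"
      by (rule integrable_of_interaction_finite[OF _ _ _ K k ae(1) ae(2) fin1]) measurable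
    show "integrable (lborel \<Otimes>\<^sub>M lborel) (\<lambda>p. indicator (F' \<inter> \<Omega>) (fst p)
        * indicator (- F' \<inter> - \<Omega>) (snd p) * k (fst p - snd p))"
      by (rule integrable_of_interaction_finite[OF _ _ _ K k ae(1) ae(4) fin2]) measurable
    show "integrable (lborel \<Otimes>\<^sub>M lborel) (\<lambda>p. indicator (- F' \<inter> \<Omega>) (fst p)
        * indicator (F' \<inter> - \<Omega>) (snd p) * k (fst p - snd p))"
      by (rule integrable_of_interaction_finite[OF _ _ _ K k ae(2) ae(3) fin3]) measurable
  qed
  show ?thesis
  proof (rule Bochner_Integration.integrable_bound)
    show "integrable (lborel \<Otimes>\<^sub>M lborel) (\<lambda>p. h p + h (snd p, fst p))"
      using h integrable_swap[OF h] by (rule Bochner_Integration.integrable_add)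
    show "AE p in lborel \<Otimes>\<^sub>M lborel. norm (indicator (UNIV - (- \<Omega>) \<times> (- \<Omega>)) p
        * (indicator F' (fst p) - indicator F' (snd p)) * k (fst p - snd p))
        \<le> norm (h p + h (snd p, fst p))"
    proof (rule AE_I2)
      fix p :: "(real ^ 'n) \<times> (real ^ 'n)"
      obtain x y where p: "p = (x, y)" by (cases p)
      have "k (y - x) = k (x - y)"
        using k_even[of "x - y"] by simp
      then show "norm (indicator (UNIV - (- \<Omega>) \<times> (- \<Omega>)) p
        * (indicator F' (fst p) - indicator F' (snd p)) * k (fst p - snd p))
        \<le> norm (h p + h (snd p, fst p))"
        unfolding p h_def using k[of "x - y"] by (auto simp: indicator_def)
    qed
  qed measurable
qed

section \<open>Passing from Lebesgue to Borel integrals\<close>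

lemma calibration_eq_product_integral:
  fixes K k \<phi> \<psi> :: "real ^ 'n \<Rightarrow> real"
  assumes [measurable]: "k \<in> borel_measurable borel" "\<psi> \<in> borel_measurable borel"
      "\<Omega> \<in> sets borel" "F' \<in> sets borel"
    and K: "AE z in lborel. K z = k z" and \<phi>: "AE x in lborel. \<phi> x = \<psi> x"
    and F: "AE x in lborel. x \<in> F \<longleftrightarrow> x \<in> F'"
  shows "calibration K \<phi> \<Omega> F =
    (\<integral>p. indicator (UNIV - (- \<Omega>) \<times> (- \<Omega>)) p * (indicator F' (fst p) - indicator F' (snd p))
        * (sgn (\<psi> (fst p) - \<psi> (snd p)) * k (fst p - snd p)) \<partial>(lborel \<Otimes>\<^sub>M lborel))"
  unfolding calibration_def set_lebesgue_integral_def lborel_prod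
proof (rule integral_lebesgue_eq_lborel)
  have "(\<lambda>p. indicator (UNIV - (- \<Omega>) \<times> (- \<Omega>)) p * (indicator F' (fst p) - indicator F' (snd p))
        * (sgn (\<psi> (fst p) - \<psi> (snd p)) * k (fst p - snd p))) \<in> borel_measurable (borel \<Otimes>\<^sub>M borel)"
    by measurable
  then show "(\<lambda>p. indicator (UNIV - (- \<Omega>) \<times> (- \<Omega>)) p * (indicator F' (fst p) - indicator F' (snd p))
        * (sgn (\<psi> (fst p) - \<psi> (snd p)) * k (fst p - snd p))) \<in> borel_measurable borel"
    by (simp only: borel_prod)
  have "AE p in lborel \<Otimes>\<^sub>M lborel.
      indicator (UNIV - (- \<Omega>) \<times> (- \<Omega>)) p *\<^sub>R (sgn (\<phi> (fst p) - \<phi> (snd p))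
        * (indicator F (fst p) - indicator F (snd p)) * K (fst p - snd p)) =
      indicator (UNIV - (- \<Omega>) \<times> (- \<Omega>)) p * (indicator F' (fst p) - indicator F' (snd p))
        * (sgn (\<psi> (fst p) - \<psi> (snd p)) * k (fst p - snd p))"
    using AE_lborel_fst[OF \<phi>] AE_lborel_snd[OF \<phi>] AE_lborel_fst[OF F] AE_lborel_snd[OF F]
      AE_lborel_diff[OF K]
    by eventually_elim (simp add: indicator_def)
  then show "AE p in lborel.
      indicator (UNIV - (- \<Omega>) \<times> (- \<Omega>)) p *\<^sub>R (sgn (\<phi> (fst p) - \<phi> (snd p))
        * (indicator F (fst p) - indicator F (snd p)) * K (fst p - snd p)) =
      indicator (UNIV - (- \<Omega>) \<times> (- \<Omega>)) p * (indicator F' (fst p) - indicator F' (snd p))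
        * (sgn (\<psi> (fst p) - \<psi> (snd p)) * k (fst p - snd p))"
    by (simp only: lborel_prod)
qed

lemma set_integral_sgn_kernel_eq:
  fixes K k \<phi> \<psi> :: "'a::euclidean_space \<Rightarrow> real"
  assumes [measurable]: "k \<in> borel_measurable borel" "\<psi> \<in> borel_measurable borel" "B \<in> sets borel"
    and K: "AE z in lborel. K z = k z" and \<phi>: "AE x in lborel. \<phi> x = \<psi> x" and x: "\<phi> x = \<psi> x"
  shows "(LINT y:B|lebesgue. sgn (\<phi> x - \<phi> y) * K (x - y))
    = (\<integral>y. indicator B y * (sgn (\<psi> x - \<psi> y) * k (x - y)) \<partial>lborel)"
  unfolding set_lebesgue_integral_def
proof (rule integral_lebesgue_eq_lborel)
  show "AE y in lborel. indicator B y *\<^sub>R (sgn (\<phi> x - \<phi> y) * K (x - y))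
      = indicator B y * (sgn (\<psi> x - \<psi> y) * k (x - y))"
    using \<phi> AE_lborel_reflect[OF K, of x] by eventually_elim (simp add: x)
qed measurable

lemma set_integral_eq_lborel:
  fixes f g :: "'a::euclidean_space \<Rightarrow> real"
  assumes [measurable]: "g \<in> borel_measurable borel" "A' \<in> sets borel"
    and A: "AE x in lborel. x \<in> A \<longleftrightarrow> x \<in> A'" and f: "AE x in lborel. f x = g x"
  shows "(LINT x:A|lebesgue. f x) = (\<integral>x. indicator A' x * g x \<partial>lborel)"
  unfolding set_lebesgue_integral_def
  by (rule integral_lebesgue_eq_lborel, measurable)
     (use A f in eventually_elim, simp add: indicator_def)

section \<open>The calibration formula\<close>

lemma tendsto_L1_on_set_integral:
  fixes f :: "'i \<Rightarrow> real ^ 'n \<Rightarrow> real"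
  assumes L1: "tendsto_L1_on \<Omega> f g \<F>" and A: "A \<in> sets lebesgue" "A \<subseteq> \<Omega>"
  shows "((\<lambda>i. LINT x:A|lebesgue. f i x) \<longlongrightarrow> (LINT x:A|lebesgue. g x)) \<F>"
proof -
  have g: "set_integrable lebesgue \<Omega> g"
    and f: "\<forall>\<^sub>F i in \<F>. set_integrable lebesgue \<Omega> (f i)"
    and lim: "((\<lambda>i. LINT x:\<Omega>|lebesgue. \<bar>f i x - g x\<bar>) \<longlongrightarrow> 0) \<F>"
    using L1 unfolding tendsto_L1_on_def by auto
  have "\<forall>\<^sub>F i in \<F>. norm ((LINT x:A|lebesgue. f i x) - (LINT x:A|lebesgue. g x))
      \<le> (LINT x:\<Omega>|lebesgue. \<bar>f i x - g x\<bar>)"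
    using f
  proof eventually_elim
    fix i assume fi: "set_integrable lebesgue \<Omega> (f i)"
    have d: "set_integrable lebesgue \<Omega> (\<lambda>x. f i x - g x)"
      using fi g by (rule set_integral_diff)
    have dA: "set_integrable lebesgue A (\<lambda>x. f i x - g x)"
      using d A by (rule set_integrable_subset)
    have "(LINT x:A|lebesgue. f i x) - (LINT x:A|lebesgue. g x) = (LINT x:A|lebesgue. f i x - g x)"
      using set_integrable_subset[OF fi A] set_integrable_subset[OF g A]
      by (simp add: set_integral_diff)
    also have "norm \<dots> \<le> (LINT x|lebesgue. norm (indicator A x *\<^sub>R (f i x - g x)))"
      unfolding set_lebesgue_integral_def by (rule integral_norm_bound)
    also have "\<dots> \<le> (LINT x|lebesgue. indicator \<Omega> x *\<^sub>R \<bar>f i x - g x\<bar>)"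
    proof (rule integral_mono)
      show "integrable lebesgue (\<lambda>x. norm (indicator A x *\<^sub>R (f i x - g x)))"
        using dA unfolding set_integrable_def by (rule integrable_norm)
      show "integrable lebesgue (\<lambda>x. indicator \<Omega> x *\<^sub>R \<bar>f i x - g x\<bar>)"
        using set_integrable_abs[OF d] unfolding set_integrable_def .
      show "norm (indicator A x *\<^sub>R (f i x - g x)) \<le> indicator \<Omega> x *\<^sub>R \<bar>f i x - g x\<bar>" for x
        using A(2) by (auto simp: indicator_def)
    qed
    finally show "norm ((LINT x:A|lebesgue. f i x) - (LINT x:A|lebesgue. g x))
      \<le> (LINT x:\<Omega>|lebesgue. \<bar>f i x - g x\<bar>)"
      unfolding set_lebesgue_integral_def .
  qed
  then have "((\<lambda>i. (LINT x:A|lebesgue. f i x) - (LINT x:A|lebesgue. g x)) \<longlongrightarrow> 0) \<F>"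
    using lim by (rule Lim_null_comparison)
  then show ?thesis
    by (simp only: LIM_zero_iff)
qed

theorem proposition2p3:
  fixes K :: "real ^ 'n \<Rightarrow> real"
    and \<Omega> E :: "(real ^ 'n) set"
    and \<phi> :: "real ^ 'n \<Rightarrow> real"
  assumes K_measurable: "K \<in> borel_measurable lebesgue"
    and K_nonneg: "\<And>z. 0 \<le> K z"
    and K_even: "\<And>z. K (- z) = K z"
    and K_finite: "(\<integral>\<^sup>+ z. ennreal (min 1 (norm z) * K z) \<partial>lebesgue) < \<infinity>"
    and \<Omega>_bounded: "bounded \<Omega>"
    and \<Omega>_open: "open \<Omega>"
    and \<Omega>_perimeter: "nonlocal_perimeter K \<Omega> < \<infinity>"
    and E_measurable: "E \<in> sets lebesgue"
    and \<phi>_measurable: "\<phi> \<in> borel_measurable lebesgue"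
    and E_superlevel: "AE x in lebesgue. x \<in> E \<longleftrightarrow> \<phi> x > 0"
    and curvature_ex: "AE x in lebesgue. x \<in> \<Omega> \<longrightarrow> curvature_exists K \<phi> x"
    and curvature_L1: "tendsto_L1_on \<Omega> (truncated_curvature K \<phi>) (nonlocal_curvature K \<phi>) (at_right 0)"
  shows "\<forall>F. F \<in> sets lebesgue \<and> F - \<Omega> = E - \<Omega> \<and> nonlocal_perimeter_in K \<Omega> F < \<infinity> \<longrightarrow>
    calibration K \<phi> \<Omega> F =
      2 * (LINT x:F \<inter> \<Omega>|lebesgue. nonlocal_curvature K \<phi> x)
      + 2 * (LINT x:E - \<Omega>|lebesgue. LINT y:\<Omega>|lebesgue. sgn (\<phi> x - \<phi> y) * K (x - y))"
proof (intro allI impI, elim conjE)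
  fix F
  assume F_measurable: "F \<in> sets lebesgue" and F_E: "F - \<Omega> = E - \<Omega>"
    and F_perimeter: "nonlocal_perimeter_in K \<Omega> F < \<infinity>"
  have [measurable]: "\<Omega> \<in> sets borel"
    using \<Omega>_open by simp
  obtain k where [measurable]: "k \<in> borel_measurable borel"
    and k_nonneg: "\<And>z. 0 \<le> k z" and k_even: "\<And>z. k (- z) = k z"
    and Kk: "AE z in lborel. K z = k z"
    using even_borel_representative[OF K_measurable K_nonneg K_even] by metis
  obtain \<psi> where [measurable]: "\<psi> \<in> borel_measurable borel"
    and \<phi>\<psi>: "AE x in lborel. \<phi> x = \<psi> x"
    using completion_ex_borel_measurable_real[OF \<phi>_measurable] by auto
  define F' where "F' = main_part lborel F"
  have [measurable]: "F' \<in> sets borel"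
    using main_part_sets[OF F_measurable] by (simp add: F'_def)
  have FF': "AE x in lborel. x \<in> F \<longleftrightarrow> x \<in> F'"
    using AE_in_main_part[OF F_measurable] unfolding F'_def by (auto elim: eventually_mono)
  define a where "a p = sgn (\<psi> (fst p) - \<psi> (snd p)) * k (fst p - snd p)" for p
  have a_measurable[measurable]: "a \<in> borel_measurable (lborel \<Otimes>\<^sub>M lborel)"
    unfolding a_def by measurable
  have abs_a: "\<bar>a p\<bar> \<le> k (fst p - snd p)" for p
    using k_nonneg[of "fst p - snd p"] by (auto simp: a_def abs_mult sgn_if)
  define \<epsilon> :: "nat \<Rightarrow> real" where "\<epsilon> n = inverse (real (Suc n))" for n
  have \<epsilon>_pos: "0 < \<epsilon> n" for n
    by (simp add: \<epsilon>_def)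
  have \<epsilon>_null: "\<epsilon> \<longlonglongrightarrow> 0"
    unfolding \<epsilon>_def by (rule LIMSEQ_inverse_real_of_nat)
  have \<epsilon>_right: "filterlim \<epsilon> (at_right 0) sequentially"
    using \<epsilon>_null \<epsilon>_pos by (intro tendsto_imp_filterlim_at_right) auto
  define T where "T n = {p :: (real ^ 'n) \<times> (real ^ 'n). \<epsilon> n \<le> dist (fst p) (snd p)}" for n
  have T_measurable[measurable]: "T n \<in> sets (lborel \<Otimes>\<^sub>M lborel)" for n
  proof -
    have "closed (T n)"
      unfolding T_def by (intro closed_Collect_le continuous_intros)
    then have "T n \<in> sets borel"
      by (rule borel_closed)
    then show ?thesis
      by (simp only: lborel_prod sets_lborel)
  qed

  have trunc: "AE x in lborel. truncated_curvature K \<phi> (\<epsilon> n) x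
      = (\<integral>y. indicator (T n) (x, y) * a (x, y) \<partial>lborel)" for n
    using \<phi>\<psi>
  proof eventually_elim
    case (elim x)
    have "truncated_curvature K \<phi> (\<epsilon> n) x
        = (\<integral>y. indicator (- ball x (\<epsilon> n)) y * (sgn (\<psi> x - \<psi> y) * k (x - y)) \<partial>lborel)"
      unfolding truncated_curvature_def using Kk \<phi>\<psi> elim
      by (intro set_integral_sgn_kernel_eq) auto
    then show ?case
      by (simp add: a_def T_def indicator_def not_less)
  qed
  have lim: "(\<lambda>n. \<integral>x. indicator (F' \<inter> \<Omega>) x * (\<integral>y. indicator (T n) (x, y) * a (x, y) \<partial>lborel) \<partial>lborel)
      \<longlonglongrightarrow> (LINT x:F \<inter> \<Omega>|lebesgue. nonlocal_curvature K \<phi> x)"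
  proof -
    have "(\<lambda>n. LINT x:F \<inter> \<Omega>|lebesgue. truncated_curvature K \<phi> (\<epsilon> n) x)
        \<longlonglongrightarrow> (LINT x:F \<inter> \<Omega>|lebesgue. nonlocal_curvature K \<phi> x)"
      using F_measurable \<Omega>_open
      by (intro filterlim_compose[OF tendsto_L1_on_set_integral[OF curvature_L1] \<epsilon>_right]) auto
    moreover have "(LINT x:F \<inter> \<Omega>|lebesgue. truncated_curvature K \<phi> (\<epsilon> n) x)
        = (\<integral>x. indicator (F' \<inter> \<Omega>) x * (\<integral>y. indicator (T n) (x, y) * a (x, y) \<partial>lborel) \<partial>lborel)" for n
    proof (rule set_integral_eq_lborel[OF _ _ _ trunc])
      show "AE x in lborel. x \<in> F \<inter> \<Omega> \<longleftrightarrow> x \<in> F' \<inter> \<Omega>"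
        using FF' by (auto elim: eventually_mono)
    qed measurable
    ultimately show ?thesis by simp
  qed
  have "calibration K \<phi> \<Omega> F = (\<integral>p. indicator (UNIV - (- \<Omega>) \<times> (- \<Omega>)) p
      * (indicator F' (fst p) - indicator F' (snd p)) * a p \<partial>(lborel \<Otimes>\<^sub>M lborel))"
    unfolding a_def using Kk \<phi>\<psi> FF' by (intro calibration_eq_product_integral) auto
  also have "\<dots> = 2 * (LINT x:F \<inter> \<Omega>|lebesgue. nonlocal_curvature K \<phi> x)
      + 2 * (\<integral>x. indicator (F' - \<Omega>) x * (\<integral>y. indicator \<Omega> y * a (x, y) \<partial>lborel) \<partial>lborel)"
  proof (rule calibration_identity_limit[OF _ _ T_measurable a_measurable _ _ _ _ _ _ lim])
    show "a (y, x) = - a (x, y)" for x y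
      using k_even[of "x - y"] sgn_minus[of "\<psi> x - \<psi> y"] by (simp add: a_def)
    show "(y, x) \<in> T n \<longleftrightarrow> (x, y) \<in> T n" for n x y
      by (simp add: T_def dist_commute)
    \<comment> \<open>The kernel vanishes on the diagonal since \<open>sgn 0 = 0\<close>.\<close>
    show "\<forall>\<^sub>F n in sequentially. p \<in> T n" if "a p \<noteq> 0" for p
    proof -
      have "0 < dist (fst p) (snd p)"
        using that by (auto simp: a_def)
      from order_tendstoD(2)[OF \<epsilon>_null this] show ?thesis
        by eventually_elim (simp add: T_def)
    qed
    show "integrable (lborel \<Otimes>\<^sub>M lborel) (\<lambda>p. indicator (\<Omega> \<times> UNIV) p * (indicator (T n) p * a p))" for n
    proof (rule Bochner_Integration.integrable_bound)
      have "(\<integral>\<^sup>+ z. ennreal (min 1 (norm z) * k z) \<partial>lborel)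
          = (\<integral>\<^sup>+ z. ennreal (min 1 (norm z) * K z) \<partial>lborel)"
        by (rule nn_integral_cong_AE) (use Kk in eventually_elim, simp)
      also have "\<dots> < \<infinity>"
        using K_finite by (simp add: nn_integral_completion)
      finally show "integrable (lborel \<Otimes>\<^sub>M lborel) (\<lambda>p. indicator \<Omega> (fst p)
          * (if \<epsilon> n \<le> dist (fst p) (snd p) then k (fst p - snd p) else 0))"
        using k_nonneg emeasure_bounded_finite[OF \<Omega>_bounded] \<epsilon>_pos
        by (intro integrable_kernel_off_diagonal) auto
      show "AE p in lborel \<Otimes>\<^sub>M lborel. norm (indicator (\<Omega> \<times> UNIV) p * (indicator (T n) p * a p))
          \<le> norm (indicator \<Omega> (fst p) * (if \<epsilon> n \<le> dist (fst p) (snd p) then k (fst p - snd p) else 0))"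
      proof (rule AE_I2)
        fix p :: "(real ^ 'n) \<times> (real ^ 'n)"
        show "norm (indicator (\<Omega> \<times> UNIV) p * (indicator (T n) p * a p))
          \<le> norm (indicator \<Omega> (fst p) * (if \<epsilon> n \<le> dist (fst p) (snd p) then k (fst p - snd p) else 0))"
          using abs_a[of p] k_nonneg[of "fst p - snd p"]
          by (cases p) (auto simp: indicator_def T_def)
      qed
    qed measurable
    show "integrable (lborel \<Otimes>\<^sub>M lborel) (\<lambda>p. indicator (UNIV - (- \<Omega>) \<times> (- \<Omega>)) p
        * (indicator F' (fst p) - indicator F' (snd p)) * a p)"
    proof (rule Bochner_Integration.integrable_bound)
      show "integrable (lborel \<Otimes>\<^sub>M lborel) (\<lambda>p. indicator (UNIV - (- \<Omega>) \<times> (- \<Omega>)) p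
          * (indicator F' (fst p) - indicator F' (snd p)) * k (fst p - snd p))"
        using Kk k_nonneg k_even FF' F_perimeter by (intro integrable_jump_kernel) auto
      show "AE p in lborel \<Otimes>\<^sub>M lborel. norm (indicator (UNIV - (- \<Omega>) \<times> (- \<Omega>)) p
          * (indicator F' (fst p) - indicator F' (snd p)) * a p)
        \<le> norm (indicator (UNIV - (- \<Omega>) \<times> (- \<Omega>)) p
          * (indicator F' (fst p) - indicator F' (snd p)) * k (fst p - snd p))"
        by (intro AE_I2, simp only: norm_mult, intro mult_left_mono)
           (use abs_a k_nonneg in auto)
    qed measurable
    show "integrable (lborel \<Otimes>\<^sub>M lborel) (\<lambda>p. indicator ((- \<Omega>) \<times> \<Omega>) p * a p)"
    proof (rule Bochner_Integration.integrable_bound)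
      have "integrable (lborel \<Otimes>\<^sub>M lborel)
          (\<lambda>p. indicator \<Omega> (fst p) * indicator (- \<Omega>) (snd p) * k (fst p - snd p))"
        using \<Omega>_perimeter Kk k_nonneg unfolding nonlocal_perimeter_def
        by (intro integrable_of_interaction_finite[where K = K]) auto
      from integrable_swap[OF this] show "integrable (lborel \<Otimes>\<^sub>M lborel)
          (\<lambda>p. indicator \<Omega> (snd p) * indicator (- \<Omega>) (fst p) * k (snd p - fst p))"
        by simp
      show "AE p in lborel \<Otimes>\<^sub>M lborel. norm (indicator ((- \<Omega>) \<times> \<Omega>) p * a p)
          \<le> norm (indicator \<Omega> (snd p) * indicator (- \<Omega>) (fst p) * k (snd p - fst p))"
      proof (rule AE_I2)
        fix p :: "(real ^ 'n) \<times> (real ^ 'n)"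
        show "norm (indicator ((- \<Omega>) \<times> \<Omega>) p * a p)
          \<le> norm (indicator \<Omega> (snd p) * indicator (- \<Omega>) (fst p) * k (snd p - fst p))"
          using abs_a[of p] k_even[of "fst p - snd p"]
          by (cases p) (auto simp: indicator_def)
      qed
    qed measurable
  qed auto
  also have "(\<integral>x. indicator (F' - \<Omega>) x * (\<integral>y. indicator \<Omega> y * a (x, y) \<partial>lborel) \<partial>lborel)
      = (LINT x:E - \<Omega>|lebesgue. LINT y:\<Omega>|lebesgue. sgn (\<phi> x - \<phi> y) * K (x - y))"
  proof (rule set_integral_eq_lborel[symmetric])
    show "AE x in lborel. x \<in> E - \<Omega> \<longleftrightarrow> x \<in> F' - \<Omega>"
      using FF' unfolding F_E[symmetric] by eventually_elim auto
    show "AE x in lborel. (LINT y:\<Omega>|lebesgue. sgn (\<phi> x - \<phi> y) * K (x - y))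
        = (\<integral>y. indicator \<Omega> y * a (x, y) \<partial>lborel)"
      using \<phi>\<psi>
    proof eventually_elim
      case (elim x)
      show ?case
        unfolding a_def fst_conv snd_conv using Kk \<phi>\<psi> elim
        by (intro set_integral_sgn_kernel_eq) auto
    qed
  qed measurable
  finally show "calibration K \<phi> \<Omega> F =
      2 * (LINT x:F \<inter> \<Omega>|lebesgue. nonlocal_curvature K \<phi> x)
      + 2 * (LINT x:E - \<Omega>|lebesgue. LINT y:\<Omega>|lebesgue. sgn (\<phi> x - \<phi> y) * K (x - y))" .
qed

end
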